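(* Let $k\ge 2$ and $m\ge 1$ be integers and let $n=km$. Consider the simultaneous sealed-bid auction of $n$ objects among $k$ bidders described in the context, with one adversary ${\mathcal A}$ and $k-1$ disadvantaged bidders. Let $g$ be the probability density on the simplex $\{(d_1,\dots,d_k): d_i>0,\ d_1+\cdots+d_k=1\}$ (with respect to Lebesgue measure in the coordinates $d_1,\dots,d_{k-1}$) given by $g(d_1,\dots,d_k)=\frac{1}{\alpha}(d_1d_2\cdots d_k)^{\frac{1}{k-1}-1}$, where $\alpha=\int_{d_1+\cdots+d_k=1}(d_1\cdots d_k)^{\frac{1}{k-1}-1}\,dd_1\cdots dd_{k-1}$. Suppose each disadvantaged bidder, independently of the others, uses the following algorithm: draw $(d_1,\dots,d_k)$ with density $g$, and for each $l=1,\dots,m$ and $i=1,\dots,k$ bid $d_i/m$ on object $(l-1)k+i$. Then, for every (possibly randomized) strategy of ${\mathcal A}$, each disadvantaged bidder wins at least $n/k$ objects in expectation. Moreover this is optimal: whenever all $k-1$ disadvantaged bidders independently use one and the same bidding algorithm, ${\mathcal A}$ has a strategy under which each disadvantaged bidder wins at most $n/k$ objects in expectation.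
   Context: Auction model: there are $k\ge2$ bidders and $n\ge k$ objects auctioned simultaneously. Each bidder has budget normalized to $1$ and submits, simultaneously, a vector of bids (one per object, positive reals) with sum at most $1$. Each object is won by the highest bidder on it at the price of his bid; if $m$ bidders tie for the highest bid, each wins with probability $1/m$. A randomized bidding algorithm is a procedure producing a random bid vector. The adversary ${\mathcal A}$ knows the bidding algorithms of all the other $k-1$ (disadvantaged) bidders, but not the outcomes of their random choices; his (possibly random) bids are independent of theirs. All bidders compete non-cooperatively, each wanting to maximize his expected number of won objects. *)

theory Defs
  imports "HOL-Probability.Probability"
begin

text \<open>Objects are indexed 0..<n, bidders 0..<k; bidder 0 is the adversary,
  bidders 1..<k are the disadvantaged bidders. A bid vector is a function
  nat => real (only the values on 0..<n matter).\<close>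

definition valid_bid :: "nat \<Rightarrow> (nat \<Rightarrow> real) \<Rightarrow> bool" where
  "valid_bid n b \<longleftrightarrow> (\<forall>t<n. b t > 0) \<and> (\<Sum>t<n. b t) \<le> 1"

definition bid_space :: "nat \<Rightarrow> (nat \<Rightarrow> real) measure" where
  "bid_space n = PiM {..<n} (\<lambda>_. borel)"

definition strategy :: "nat \<Rightarrow> (nat \<Rightarrow> real) measure \<Rightarrow> bool" where
  "strategy n M \<longleftrightarrow> prob_space M \<and> sets M = sets (bid_space n) \<and>
     (AE b in M. valid_bid n b)"

text \<open>Expected number of objects won by bidder j for a fixed bid profile p
  (ties broken uniformly at random).\<close>
definition wins :: "nat \<Rightarrow> nat \<Rightarrow> (nat \<Rightarrow> nat \<Rightarrow> real) \<Rightarrow> nat \<Rightarrow> real" where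
  "wins n k p j = (\<Sum>t<n. if (\<forall>i<k. p i t \<le> p j t)
       then 1 / real (card {i. i < k \<and> p i t = p j t}) else 0)"

definition exp_wins :: "nat \<Rightarrow> nat \<Rightarrow> (nat \<Rightarrow> real) measure \<Rightarrow> (nat \<Rightarrow> real) measure
    \<Rightarrow> nat \<Rightarrow> real" where
  "exp_wins n k A D j =
     (\<integral>p. wins n k p j \<partial>(PiM {..<k} (\<lambda>i. if i = 0 then A else D)))"

definition simplex_pt :: "nat \<Rightarrow> (nat \<Rightarrow> real) \<Rightarrow> nat \<Rightarrow> real" where
  "simplex_pt k y i = (if i < k - 1 then y i else 1 - (\<Sum>j<k-1. y j))"

definition open_simplex :: "nat \<Rightarrow> (nat \<Rightarrow> real) set" where
  "open_simplex k = {y. \<forall>i<k. simplex_pt k y i > 0}"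

definition dir_f :: "nat \<Rightarrow> (nat \<Rightarrow> real) \<Rightarrow> ennreal" where
  "dir_f k y = ennreal (indicator (open_simplex k) y *
      ((\<Prod>i<k. simplex_pt k y i) powr (1 / (real k - 1) - 1)))"

definition dir_alpha :: "nat \<Rightarrow> ennreal" where
  "dir_alpha k = (\<integral>\<^sup>+ y. dir_f k y \<partial>(PiM {..<k-1} (\<lambda>_. lborel)))"

definition dir_measure :: "nat \<Rightarrow> (nat \<Rightarrow> real) measure" where
  "dir_measure k = density (PiM {..<k-1} (\<lambda>_. lborel)) (\<lambda>y. dir_f k y / dir_alpha k)"

text \<open>The algorithm: bid d_i/m on object (l-1)k+i (1-indexed); 0-indexed, object o
  gets bid d_{o mod k} / m.\<close>
definition dir_alg :: "nat \<Rightarrow> nat \<Rightarrow> (nat \<Rightarrow> real) measure" where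
  "dir_alg k m = distr (dir_measure k) (bid_space (k * m))
     (\<lambda>y. \<lambda>t\<in>{..<k*m}. simplex_pt k y (t mod k) / real m)"

end

theory Submission
  imports Defs
begin

text \<open>The density $g$ is the Dirichlet density with all parameters $a = 1/(k-1)$, and its
  one-dimensional marginals have distribution function $x^{1/(k-1)}$ on $[0,1]$. Hence the maximum
  of the $k-1$ independent disadvantaged bids on one object is uniform on $[0,1/m]$, and a bid $b$
  wins it with probability at most $mb$: the adversary wins at most $m = n/k$ objects. The
  shares of all bidders always add up to $n$ and the disadvantaged bidders are exchangeable, so
  each of them gets at least $m$. For optimality the adversary copies the common algorithm, which
  makes all $k$ bidders exchangeable.\<close>

section \<open>Dirichlet integrals\<close>

text \<open>The unnormalised Gamma-type weight x^(a-1) on the positive reals. The cut-off at 0 puts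
  the simplex constraints into the integrand, so every integral can run over the whole
  space.\<close>

definition wt :: "real \<Rightarrow> real \<Rightarrow> ennreal" where
  "wt a x = ennreal (indicator {0<..} x * x powr (a - 1))"

lemma wt_measurable [measurable]: "wt a \<in> borel_measurable borel"
  unfolding wt_def by measurable

lemma wt_nonpos: "x \<le> 0 \<Longrightarrow> wt a x = 0"
  by (simp add: wt_def)

lemma wt_mult_scale:
  assumes "s > 0"
  shows "wt a (s * u) = ennreal (s powr (a - 1)) * wt a u"
  using assms by (cases "u > 0")
    (auto simp: wt_def powr_mult ennreal_mult zero_less_mult_iff indicator_def)

text \<open>The substitution y = s u reduces the integral to the Beta integral on [0,1]. For s \<le>
  0 both sides vanish, since y and s - y cannot both be positive.\<close>

lemma nn_integral_wt_convolution:
  assumes a: "a > 0" and b: "b > 0"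
  shows "(\<integral>\<^sup>+ y. wt a y * wt b (s - y) \<partial>lborel) = ennreal (Beta a b) * wt (a + b) s"
proof (cases "s > 0")
  case False
  have "wt a y * wt b (s - y) = 0" for y
    using False by (cases "y > 0") (simp_all add: wt_nonpos)
  then show ?thesis
    using False by (simp add: wt_nonpos del: mult_eq_0_iff)
next
  case True
  have unit: "(\<integral>\<^sup>+ u. wt a u * wt b (1 - u) \<partial>lborel) = ennreal (Beta a b)"
  proof -
    have "(\<integral>\<^sup>+ u. wt a u * wt b (1 - u) \<partial>lborel) =
        (\<integral>\<^sup>+ u. ennreal (u powr (a - 1) * (1 - u) powr (b - 1)) * indicator {0..1} u \<partial>lborel)"
      \<comment> \<open>The closed interval does no harm: \<open>0 powr x = 0\<close>, so both
        integrands are 0 at the endpoints.\<close>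
      by (intro nn_integral_cong) (auto simp: wt_def indicator_def ennreal_mult)
    also have "\<dots> = ennreal (Beta a b)"
      using has_integral_Beta_real[OF a b] by (intro nn_integral_has_integral_lebesgue') auto
    finally show ?thesis .
  qed
  have "(\<integral>\<^sup>+ y. wt a y * wt b (s - y) \<partial>lborel)
      = \<bar>s\<bar> * (\<integral>\<^sup>+ u. wt a (0 + s * u) * wt b (s - (0 + s * u)) \<partial>lborel)"
    using True by (intro nn_integral_real_affine) auto
  also have "\<dots> = s * (\<integral>\<^sup>+ u. ennreal (s powr (a - 1) * s powr (b - 1)) * (wt a u * wt b (1 - u)) \<partial>lborel)"
  proof -
    have "wt a (0 + s * u) * wt b (s - (0 + s * u)) =
        ennreal (s powr (a - 1) * s powr (b - 1)) * (wt a u * wt b (1 - u))" for u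
    proof -
      have "wt a (0 + s * u) = ennreal (s powr (a - 1)) * wt a u"
        using wt_mult_scale[OF True] by simp
      moreover have "wt b (s - (0 + s * u)) = ennreal (s powr (b - 1)) * wt b (1 - u)"
        using wt_mult_scale[OF True, of b "1 - u"] by (simp add: right_diff_distrib)
      ultimately show ?thesis
        by (simp add: ennreal_mult mult_ac del: add_0)
    qed
    then show ?thesis
      using True by simp
  qed
  also have "\<dots> = ennreal (s * (s powr (a - 1) * s powr (b - 1))) * ennreal (Beta a b)"
    using True by (subst nn_integral_cmult) (simp_all add: unit ennreal_mult mult_ac)
  \<comment> \<open>The Jacobian contributes the factor s, giving the exponent 1 + (a-1) + (b-1) = a
    + b - 1.\<close>
  also have "s * (s powr (a - 1) * s powr (b - 1)) = s powr (a + b - 1)"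
    using True by (simp add: powr_mult_base flip: powr_add)
  finally show ?thesis
    using True by (simp add: wt_def mult_ac)
qed

section \<open>Dirichlet weights in several variables: total mass, marginals, reflection\<close>

interpretation lborel_product: product_sigma_finite "\<lambda>_::nat. lborel :: real measure"
  by standard

text \<open>The unnormalised Dirichlet density for total s: the coordinates in \<open>I\<close>
  carry the parameter a, the dependent last coordinate the parameter b. The total is a variable
  because splitting off a coordinate x leaves the same kind of weight with total s - x.\<close>

definition dirichlet_weight :: "nat set \<Rightarrow> real \<Rightarrow> real \<Rightarrow> real \<Rightarrow> (nat \<Rightarrow> real) \<Rightarrow> ennreal" where
  "dirichlet_weight I a b s y = (\<Prod>i\<in>I. wt a (y i)) * wt b (s - (\<Sum>i\<in>I. y i))"

lemma dirichlet_weight_measurable [measurable]: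
  "dirichlet_weight I a b s \<in> borel_measurable (PiM I (\<lambda>_. lborel))"
  unfolding dirichlet_weight_def by measurable

lemma dirichlet_weight_insert:
  assumes "finite I" "i \<notin> I"
  shows "dirichlet_weight (insert i I) a b s (y(i := x)) = wt a x * dirichlet_weight I a b (s - x) y"
proof -
  have "(\<Prod>j\<in>I. wt a ((y(i := x)) j)) = (\<Prod>j\<in>I. wt a (y j))"
       "(\<Sum>j\<in>I. (y(i := x)) j) = (\<Sum>j\<in>I. y j)"
    using assms(2) by (auto intro!: prod.cong sum.cong)
  then show ?thesis
    using assms by (simp add: dirichlet_weight_def algebra_simps)
qed

text \<open>Induction on \<open>I\<close>: each further coordinate is one more convolution with
  \<open>wt a\<close>, which adds a to the exponent and a Beta factor to the constant. The constant
  must not depend on s, because the induction hypothesis is applied at s - x for all x. Its exact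
  value cancels later, so positivity suffices.\<close>

lemma nn_integral_dirichlet_weight:
  fixes a b :: real
  assumes "finite I" and a: "a > 0" and b: "b > 0"
  shows "\<exists>c>0. \<forall>s. (\<integral>\<^sup>+ y. dirichlet_weight I a b s y \<partial>PiM I (\<lambda>_. lborel)) =
           ennreal c * wt (card I * a + b) s"
  using assms(1)
proof (induction I rule: finite_induct)
  case empty
  show ?case
    by (intro exI[of _ 1]) (simp add: dirichlet_weight_def PiM_empty)
next
  case (insert i I)
  then obtain c where c: "c > 0" and IH: "\<And>s. (\<integral>\<^sup>+ y. dirichlet_weight I a b s y \<partial>PiM I (\<lambda>_. lborel)) =
           ennreal c * wt (card I * a + b) s" by blast
  have pos: "card I * a + b > 0"
    using a b by (simp add: add_nonneg_pos)
  have "(\<integral>\<^sup>+ y. dirichlet_weight (insert i I) a b s y \<partial>PiM (insert i I) (\<lambda>_. lborel)) =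
      ennreal (c * Beta a (card I * a + b)) * wt (card (insert i I) * a + b) s" for s
  proof -
    have "(\<integral>\<^sup>+ y. dirichlet_weight (insert i I) a b s y \<partial>PiM (insert i I) (\<lambda>_. lborel)) =
        (\<integral>\<^sup>+ x. (\<integral>\<^sup>+ y. wt a x * dirichlet_weight I a b (s - x) y \<partial>PiM I (\<lambda>_. lborel)) \<partial>lborel)"
      using insert.hyps by (subst lborel_product.product_nn_integral_insert_rev)
        (simp_all add: dirichlet_weight_insert)
    also have "\<dots> = (\<integral>\<^sup>+ x. ennreal c * (wt a x * wt (card I * a + b) (s - x)) \<partial>lborel)"
      by (simp add: nn_integral_cmult IH mult_ac)
    also have "\<dots> = ennreal c * (ennreal (Beta a (card I * a + b)) * wt (a + (card I * a + b)) s)"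
      using a pos by (subst nn_integral_cmult) (simp_all add: nn_integral_wt_convolution)
    finally show ?thesis
      using insert.hyps c by (simp add: ennreal_mult' mult_ac algebra_simps)
  qed
  moreover have "c * Beta a (card I * a + b) > 0"
    using c a pos by (simp add: Beta_def)
  ultimately show ?case by blast
qed

text \<open>Integrating out all coordinates but i merges them with the last one into a single weight
  with the summed parameter. As c is the same for all h, the choice h = 1 later identifies the
  normalising constant.\<close>

lemma nn_integral_dirichlet_marginal:
  assumes "finite I" "i \<in> I" and a: "a > 0" and b: "b > 0"
  shows "\<exists>c>0. \<forall>h \<in> borel_measurable borel.
     (\<integral>\<^sup>+ y. h (y i) * dirichlet_weight I a b s y \<partial>PiM I (\<lambda>_. lborel)) =
     ennreal c * (\<integral>\<^sup>+ x. h x * wt a x * wt ((real (card I) - 1) * a + b) (s - x) \<partial>lborel)"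
proof -
  define J where "J = I - {i}"
  have J: "finite J" "i \<notin> J" "I = insert i J"
    using assms by (auto simp: J_def)
  have card_I: "real (card I) - 1 = real (card J)"
    using J by simp
  obtain c where c: "c > 0" and int: "\<And>s. (\<integral>\<^sup>+ y. dirichlet_weight J a b s y \<partial>PiM J (\<lambda>_. lborel)) =
           ennreal c * wt (card J * a + b) s"
    using nn_integral_dirichlet_weight[OF J(1) a b] by blast
  have "(\<integral>\<^sup>+ y. h (y i) * dirichlet_weight I a b s y \<partial>PiM I (\<lambda>_. lborel)) =
     ennreal c * (\<integral>\<^sup>+ x. h x * wt a x * wt ((real (card I) - 1) * a + b) (s - x) \<partial>lborel)"
    if h [measurable]: "h \<in> borel_measurable borel" for h
  proof -
    have "(\<integral>\<^sup>+ y. h (y i) * dirichlet_weight I a b s y \<partial>PiM I (\<lambda>_. lborel)) =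
        (\<integral>\<^sup>+ x. (\<integral>\<^sup>+ y. (h x * wt a x) * dirichlet_weight J a b (s - x) y \<partial>PiM J (\<lambda>_. lborel)) \<partial>lborel)"
      unfolding \<open>I = insert i J\<close> using J(1,2)
      by (subst lborel_product.product_nn_integral_insert_rev)
        (simp_all add: dirichlet_weight_insert mult_ac)
    also have "\<dots> = (\<integral>\<^sup>+ x. ennreal c * (h x * wt a x * wt (card J * a + b) (s - x)) \<partial>lborel)"
      by (simp add: nn_integral_cmult int mult_ac)
    finally show ?thesis
      unfolding card_I by (simp add: nn_integral_cmult)
  qed
  with c show ?thesis by blast
qed

text \<open>With equal parameters the dependent last coordinate is distributed like any free one:
  for fixed other coordinates with remainder r, the map x \<mapsto> r - x exchanges coordinate i
  with the last coordinate and preserves the weight.\<close>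

lemma nn_integral_dirichlet_reflect:
  assumes "finite I" "i \<in> I" and h [measurable]: "h \<in> borel_measurable borel"
  shows "(\<integral>\<^sup>+ y. h (s - (\<Sum>j\<in>I. y j)) * dirichlet_weight I a a s y \<partial>PiM I (\<lambda>_. lborel)) =
     (\<integral>\<^sup>+ y. h (y i) * dirichlet_weight I a a s y \<partial>PiM I (\<lambda>_. lborel))"
proof -
  define J where "J = I - {i}"
  have J: "finite J" "i \<notin> J" "I = insert i J"
    using assms by (auto simp: J_def)
  have sum_J: "(\<Sum>j\<in>J. if j = i then x else y j) = (\<Sum>j\<in>J. y j)" for y :: "nat \<Rightarrow> real" and x
    using J(2) by (intro sum.cong) auto
  have refl: "(\<integral>\<^sup>+ x. h (s - (x + (\<Sum>j\<in>J. y j))) * (wt a x * dirichlet_weight J a a (s - x) y) \<partial>lborel) =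
     (\<integral>\<^sup>+ x. h x * (wt a x * dirichlet_weight J a a (s - x) y) \<partial>lborel)" for y
  proof -
    define r where "r = s - (\<Sum>j\<in>J. y j)"
    have w: "dirichlet_weight J a a (s - x) y = (\<Prod>i\<in>J. wt a (y i)) * wt a (r - x)" for x
      by (simp add: dirichlet_weight_def r_def algebra_simps)
    have "(\<integral>\<^sup>+ x. h x * (wt a x * ((\<Prod>i\<in>J. wt a (y i)) * wt a (r - x))) \<partial>lborel) =
        \<bar>-1::real\<bar> * (\<integral>\<^sup>+ x. h (r + (-1) * x) * (wt a (r + (-1) * x) *
            ((\<Prod>i\<in>J. wt a (y i)) * wt a (r - (r + (-1) * x)))) \<partial>lborel)"
      by (intro nn_integral_real_affine) auto
    then show ?thesis
      by (simp add: w) (simp add: r_def algebra_simps)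
  qed
  \<comment> \<open>Here coordinate i is the inner integral, so that \<open>refl\<close> applies for
    each fixed choice of the others.\<close>
  show ?thesis
    unfolding \<open>I = insert i J\<close> using J(1,2)
    by (simp add: lborel_product.product_nn_integral_insert dirichlet_weight_insert sum_J refl)
qed

section \<open>The density g as a Dirichlet weight, and its marginals\<close>

lemma dir_f_eq_dirichlet_weight:
  assumes "k \<ge> 2"
  shows "dir_f k y = dirichlet_weight {..<k-1} (1 / (real k - 1)) (1 / (real k - 1)) 1 y"
proof -
  define a where "a = 1 / (real k - 1)"
  have k: "k = Suc (k - 1)"
    using assms by simp
  have "dirichlet_weight {..<k-1} a a 1 y = (\<Prod>i<Suc (k - 1). wt a (simplex_pt k y i))"
    by (simp add: dirichlet_weight_def simplex_pt_def)
  also have "\<dots> = (\<Prod>i<k. wt a (simplex_pt k y i))"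
    using k by simp
  also have "\<dots> = dir_f k y"
  proof (cases "y \<in> open_simplex k")
    case True
    then have "simplex_pt k y i > 0" if "i < k" for i
      using that by (simp add: open_simplex_def)
    then show ?thesis
      using True by (simp add: dir_f_def wt_def a_def prod_powr_distrib less_imp_le prod_ennreal)
  next
    case False
    \<comment> \<open>Off the simplex some coordinate is not positive, and its factor
      \<open>wt\<close> kills the whole product, just as the indicator does in
      \<open>dir_f\<close>.\<close>
    then obtain i where "i < k" "simplex_pt k y i \<le> 0"
      by (auto simp: open_simplex_def not_less)
    then have "(\<Prod>i<k. wt a (simplex_pt k y i)) = 0"
      by (intro prod_zero) (auto simp: wt_nonpos intro!: bexI[of _ i])
    then show ?thesis
      using False by (simp add: dir_f_def)
  qed
  finally show ?thesis
    by (simp add: a_def)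
qed

lemma simplex_pt_measurable [measurable]:
  "(\<lambda>y. simplex_pt k y i) \<in> borel_measurable (PiM {..<k-1} (\<lambda>_. lborel))"
proof (cases "i < k - 1")
  case True
  then show ?thesis
    by (simp add: simplex_pt_def measurable_component_singleton[of i "{..<k-1}" "\<lambda>_. lborel", simplified])
next
  case False
  then show ?thesis
    unfolding simplex_pt_def if_not_P[OF False]
    by (intro borel_measurable_diff borel_measurable_const borel_measurable_sum) simp
qed

lemma dir_f_measurable [measurable]:
  "k \<ge> 2 \<Longrightarrow> dir_f k \<in> borel_measurable (PiM {..<k-1} (\<lambda>_. lborel))"
  using dirichlet_weight_measurable[of "{..<k-1}" "1 / (real k - 1)" "1 / (real k - 1)" 1]
  by (subst measurable_cong[OF dir_f_eq_dirichlet_weight]) simp_all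

text \<open>With $a = 1/(k-1)$ the exponent $(k-1)a - 1$ vanishes, so each coordinate has the plain
  power density $x^{a-1}$ on $(0,1)$.\<close>

lemma dir_f_marginal:
  assumes "k \<ge> 2" "i < k"
  shows "\<exists>c>0. \<forall>h \<in> borel_measurable borel.
     (\<integral>\<^sup>+ y. h (simplex_pt k y i) * dir_f k y \<partial>PiM {..<k-1} (\<lambda>_. lborel)) =
     ennreal c * (\<integral>\<^sup>+ x. h x * wt (1 / (real k - 1)) x * wt 1 (1 - x) \<partial>lborel)"
proof -
  define a where "a = 1 / (real k - 1)"
  \<comment> \<open>The last coordinate i = k - 1 is not a variable of integration; by reflection
    coordinate 0 can stand in for it, which exists because k \<ge> 2.\<close>
  define i' where "i' = (if i < k - 1 then i else 0)"
  have i': "i' \<in> {..<k-1}"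
    using assms by (auto simp: i'_def)
  have a: "a > 0"
    using assms by (simp add: a_def)
  have exponent: "(real (card {..<k-1}) - 1) * a + a = 1"
    using assms by (simp add: a_def of_nat_diff field_simps)
  obtain c where c: "c > 0" and marginal: "\<And>h. h \<in> borel_measurable borel \<Longrightarrow>
     (\<integral>\<^sup>+ y. h (y i') * dirichlet_weight {..<k-1} a a 1 y \<partial>PiM {..<k-1} (\<lambda>_. lborel)) =
     ennreal c * (\<integral>\<^sup>+ x. h x * wt a x * wt 1 (1 - x) \<partial>lborel)"
    using nn_integral_dirichlet_marginal[OF _ i' a a, of 1] unfolding exponent by auto
  have "(\<integral>\<^sup>+ y. h (simplex_pt k y i) * dirichlet_weight {..<k-1} a a 1 y \<partial>PiM {..<k-1} (\<lambda>_. lborel)) =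
     (\<integral>\<^sup>+ y. h (y i') * dirichlet_weight {..<k-1} a a 1 y \<partial>PiM {..<k-1} (\<lambda>_. lborel))"
    if "h \<in> borel_measurable borel" for h
  proof (cases "i < k - 1")
    case True
    then show ?thesis by (simp add: simplex_pt_def i'_def)
  next
    case False
    then show ?thesis
      using nn_integral_dirichlet_reflect[OF _ i' that, of 1 a] by (simp add: simplex_pt_def)
  qed
  then show ?thesis
    using c marginal by (intro exI[of _ c]) (simp add: dir_f_eq_dirichlet_weight[OF assms(1)] flip: a_def)
qed

text \<open>The marginal formula with h = 1 gives \<alpha> as a positive multiple of a Beta value.
  Both bounds are what makes the \<open>ennreal\<close> quotient
  \<open>dir_alpha k / dir_alpha k\<close> equal to 1.\<close>

lemma dir_alpha_pos_finite:
  assumes "k \<ge> 2"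
  shows "0 < dir_alpha k" "dir_alpha k < \<infinity>"
proof -
  define a where "a = 1 / (real k - 1)"
  have a: "a > 0"
    using assms by (simp add: a_def)
  obtain c where "c > 0" and c: "\<And>h. h \<in> borel_measurable borel \<Longrightarrow>
     (\<integral>\<^sup>+ y. h (simplex_pt k y 0) * dir_f k y \<partial>PiM {..<k-1} (\<lambda>_. lborel)) =
     ennreal c * (\<integral>\<^sup>+ x. h x * wt a x * wt 1 (1 - x) \<partial>lborel)"
    using dir_f_marginal[OF assms, of 0] assms unfolding a_def by auto
  have "dir_alpha k = ennreal c * ennreal (Beta a 1)"
    using c[of "\<lambda>_. 1"] a by (simp add: dir_alpha_def nn_integral_wt_convolution) (simp add: wt_def)
  moreover have "Beta a 1 > 0"
    using a by (simp add: Beta_def)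
  ultimately show "0 < dir_alpha k" "dir_alpha k < \<infinity>"
    using \<open>c > 0\<close> by (simp_all add: ennreal_zero_less_mult_iff ennreal_mult_less_top)
qed

section \<open>The law of the random point of the simplex\<close>

lemma prob_space_dir_measure:
  assumes "k \<ge> 2"
  shows "prob_space (dir_measure k)"
proof
  note dir_f_measurable[OF assms, measurable]
  have "emeasure (dir_measure k) (space (dir_measure k)) = 
      (\<integral>\<^sup>+ y. dir_f k y / dir_alpha k \<partial>PiM {..<k-1} (\<lambda>_. lborel))"
    unfolding dir_measure_def by (subst emeasure_density) (auto simp del: One_nat_def intro!: nn_integral_cong)
  also have "\<dots> = dir_alpha k / dir_alpha k"
    by (subst nn_integral_divide) (simp_all add: dir_alpha_def del: One_nat_def)
  also have "\<dots> = 1"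
    using dir_alpha_pos_finite[OF assms] by (intro ennreal_divide_self) auto
  finally show "emeasure (dir_measure k) (space (dir_measure k)) = 1" .
qed

lemma AE_dir_measure_open_simplex:
  assumes "k \<ge> 2"
  shows "AE y in dir_measure k. y \<in> open_simplex k"
proof -
  have "(\<lambda>y. dir_f k y / dir_alpha k) \<in> borel_measurable (PiM {..<k-1} (\<lambda>_. lborel))"
    using dir_f_measurable[OF assms] by measurable
  then show ?thesis
    unfolding dir_measure_def
    by (subst AE_density) (simp, auto simp: dir_f_def indicator_def)
qed

text \<open>Integrating the marginal density, proportional to u^(a-1) on (0,1), up to x gives x^a
  for x \<le> 1. The inequality form also covers x > 1, where x^a exceeds 1.\<close>

lemma emeasure_dir_measure_le:
  assumes "k \<ge> 2" "i < k" "x \<ge> 0"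
  shows "emeasure (dir_measure k) {y \<in> space (dir_measure k). simplex_pt k y i \<le> x} \<le>
    ennreal (x powr (1 / (real k - 1)))"
proof -
  note dir_f_measurable[OF assms(1), measurable]
  define a where "a = 1 / (real k - 1)"
  have a: "a > 0"
    using assms by (simp add: a_def)
  obtain c where "c > 0" and c: "\<And>h. h \<in> borel_measurable borel \<Longrightarrow>
     (\<integral>\<^sup>+ y. h (simplex_pt k y i) * dir_f k y \<partial>PiM {..<k-1} (\<lambda>_. lborel)) =
     ennreal c * (\<integral>\<^sup>+ x. h x * wt a x * wt 1 (1 - x) \<partial>lborel)"
    using dir_f_marginal[OF assms(1,2)] unfolding a_def by auto
  have B: "Beta a 1 > 0"
    using a by (simp add: Beta_def)
  \<comment> \<open>The constant c of the marginal formula reappears in \<alpha>, so it cancels in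
    the quotient.\<close>
  have alpha: "dir_alpha k = ennreal (c * Beta a 1)"
    using c[of "\<lambda>_. 1"] a \<open>c > 0\<close>
    by (simp add: dir_alpha_def nn_integral_wt_convolution ennreal_mult') (simp add: wt_def)
  have "(\<integral>\<^sup>+ y. indicator {..x} (simplex_pt k y i) * dir_f k y \<partial>PiM {..<k-1} (\<lambda>_. lborel)) =
      ennreal c * (\<integral>\<^sup>+ u. indicator {..x} u * wt a u * wt 1 (1 - u) \<partial>lborel)"
    by (rule c) auto
  also have "(\<integral>\<^sup>+ u. indicator {..x} u * wt a u * wt 1 (1 - u) \<partial>lborel) \<le>
      (\<integral>\<^sup>+ u. wt a u * wt 1 (x - u) \<partial>lborel)"
    \<comment> \<open>\<open>wt 1\<close> is the indicator of the positive reals, so the domination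
      holds for u < x and both sides vanish for u > x. It can fail only at u = x, a null
      set.\<close>
    using AE_lborel_singleton[of x]
    by (intro nn_integral_mono_AE, eventually_elim) (auto simp: wt_def indicator_def)
  also have "\<dots> = ennreal (Beta a 1 * x powr a)"
    using a assms(3) B by (simp add: nn_integral_wt_convolution)
      (cases "x = 0"; simp add: wt_def ennreal_mult)
  finally have bound: "(\<integral>\<^sup>+ y. indicator {..x} (simplex_pt k y i) * dir_f k y \<partial>PiM {..<k-1} (\<lambda>_. lborel))
      \<le> ennreal (c * Beta a 1 * x powr a)"
    using \<open>c > 0\<close> B by (simp add: ennreal_mult' mult.assoc mult_left_mono)
  have "emeasure (dir_measure k) {y \<in> space (dir_measure k). simplex_pt k y i \<le> x} =
      (\<integral>\<^sup>+ y. dir_f k y / dir_alpha k * indicator {y \<in> space (PiM {..<k-1} (\<lambda>_. lborel)). simplex_pt k y i \<le> x} y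
        \<partial>PiM {..<k-1} (\<lambda>_. lborel))"
    unfolding dir_measure_def by (subst emeasure_density) (auto simp del: One_nat_def)
  also have "\<dots> = (\<integral>\<^sup>+ y. indicator {..x} (simplex_pt k y i) * dir_f k y / dir_alpha k \<partial>PiM {..<k-1} (\<lambda>_. lborel))"
    by (intro nn_integral_cong) (auto simp: indicator_def)
  also have "\<dots> = (\<integral>\<^sup>+ y. indicator {..x} (simplex_pt k y i) * dir_f k y \<partial>PiM {..<k-1} (\<lambda>_. lborel)) / dir_alpha k"
    by (subst nn_integral_divide) (simp_all del: One_nat_def)
  also have "\<dots> \<le> ennreal (c * Beta a 1 * x powr a) / ennreal (c * Beta a 1)"
    unfolding alpha by (intro divide_right_mono_ennreal bound)
  also have "\<dots> = ennreal (x powr a)"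
    using \<open>c > 0\<close> B by (simp add: divide_ennreal)
  finally show ?thesis
    by (simp add: a_def)
qed

section \<open>Exchangeability of the bidders\<close>

text \<open>On each object the set \<open>W\<close> of highest bidders is nonempty, and each of its
  members sees exactly \<open>W\<close> as tied bidders, so |W| shares of 1/|W| are handed
  out.\<close>

lemma sum_wins:
  assumes "k > 0"
  shows "(\<Sum>j<k. wins n k p j) = real n"
proof -
  have share: "(\<Sum>j<k. if (\<forall>i<k. p i t \<le> p j t)
       then 1 / real (card {i. i < k \<and> p i t = p j t}) else 0) = 1" (is "?s = 1") for t
  proof -
    define W where "W = {j. j < k \<and> (\<forall>i<k. p i t \<le> p j t)}"
    have "finite W"
      by (simp add: W_def)
    have "Max ((\<lambda>i. p i t) ` {..<k}) \<in> (\<lambda>i. p i t) ` {..<k}"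
      using assms by (intro Max_in) auto
    then obtain j where j: "j < k" "Max ((\<lambda>i. p i t) ` {..<k}) = p j t"
      by auto
    have "p i t \<le> p j t" if "i < k" for i
      using that unfolding j(2)[symmetric] by (intro Max_ge) auto
    then have "W \<noteq> {}"
      using j(1) by (auto simp: W_def)
    have "?s = (\<Sum>j\<in>W. 1 / real (card {i. i < k \<and> p i t = p j t}))"
      unfolding W_def by (simp add: sum.If_cases Int_def)
    also have "\<dots> = (\<Sum>j\<in>W. 1 / real (card W))"
    proof (rule sum.cong[OF refl])
      fix j assume "j \<in> W"
      then have "{i. i < k \<and> p i t = p j t} = W"
        by (auto simp: W_def intro: order.antisym)
      then show "1 / real (card {i. i < k \<and> p i t = p j t}) = 1 / real (card W)"
        by simp
    qed
    also have "\<dots> = 1"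
      using \<open>finite W\<close> \<open>W \<noteq> {}\<close> by simp
    finally show ?thesis .
  qed
  show ?thesis
    unfolding wins_def by (subst sum.swap) (simp add: share)
qed

lemma wins_nonneg: "0 \<le> wins n k p j"
  by (auto simp: wins_def intro!: sum_nonneg)

text \<open>Counting every tie as a full win replaces the shares by events made of weak
  inequalities, whose probabilities factor over independent bidders.\<close>

lemma wins_le_count:
  assumes "j < k"
  shows "wins n k p j \<le> (\<Sum>t<n. of_bool (\<forall>i<k. p i t \<le> p j t))"
  unfolding wins_def
proof (intro sum_mono)
  fix t
  have "card {i. i < k \<and> p i t = p j t} \<noteq> 0"
    using assms by auto
  then have "1 \<le> real (card {i. i < k \<and> p i t = p j t})"
    by linarith
  then show "(if \<forall>i<k. p i t \<le> p j t then 1 / real (card {i. i < k \<and> p i t = p j t}) else 0)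
      \<le> of_bool (\<forall>i<k. p i t \<le> p j t)"
    by (auto simp: divide_le_eq)
qed

text \<open>Winning and the size of a tie depend only on the family of bids up to relabelling. The
  restriction to \<open>{..<k}\<close> keeps the permuted profile in the extensional product
  space.\<close>

lemma wins_permute:
  assumes "bij_betw f {..<k} {..<k}" "j < k"
  shows "wins n k (\<lambda>i\<in>{..<k}. p (f i)) j = wins n k p (f j)"
  unfolding wins_def
proof (rule sum.cong[OF refl])
  fix t
  have range: "f ` {..<k} = {..<k}"
    using assms(1) by (simp add: bij_betw_def)
  have inj: "inj_on f {i. i < k \<and> p (f i) t = p (f j) t}"
    using assms(1) by (auto simp: bij_betw_def inj_on_def)
  have "(\<forall>i<k. p i t \<le> p (f j) t) \<longleftrightarrow> (\<forall>i\<in>f ` {..<k}. p i t \<le> p (f j) t)"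
    unfolding range by auto
  then have max: "(\<forall>i<k. (\<lambda>i\<in>{..<k}. p (f i)) i t \<le> (\<lambda>i\<in>{..<k}. p (f i)) j t) \<longleftrightarrow>
      (\<forall>i<k. p i t \<le> p (f j) t)"
    using assms(2) by auto
  have "f ` {i. i < k \<and> p (f i) t = p (f j) t} = {i \<in> f ` {..<k}. p i t = p (f j) t}"
    by auto
  also have "\<dots> = {i. i < k \<and> p i t = p (f j) t}"
    unfolding range by auto
  finally have "card {i. i < k \<and> p i t = p (f j) t} = card {i. i < k \<and> p (f i) t = p (f j) t}"
    using card_image[of f "{i. i < k \<and> p (f i) t = p (f j) t}"] inj by simp
  also have "{i. i < k \<and> p (f i) t = p (f j) t} =
      {i. i < k \<and> (\<lambda>i\<in>{..<k}. p (f i)) i t = (\<lambda>i\<in>{..<k}. p (f i)) j t}"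
    using assms(2) by (intro Collect_cong conj_cong refl) simp
  finally have card: "card {i. i < k \<and> p i t = p (f j) t} =
      card {i. i < k \<and> (\<lambda>i\<in>{..<k}. p (f i)) i t = (\<lambda>i\<in>{..<k}. p (f i)) j t}" .
  show "(if \<forall>i<k. (\<lambda>i\<in>{..<k}. p (f i)) i t \<le> (\<lambda>i\<in>{..<k}. p (f i)) j t
        then 1 / real (card {i. i < k \<and> (\<lambda>i\<in>{..<k}. p (f i)) i t = (\<lambda>i\<in>{..<k}. p (f i)) j t}) else 0) =
      (if \<forall>i<k. p i t \<le> p (f j) t then 1 / real (card {i. i < k \<and> p i t = p (f j) t}) else 0)"
    by (simp only: max card)
qed

section \<open>Measurability and integrability of the shares\<close>

lemma bid_component_measurable:
  assumes "sets M = sets (bid_space n)" "t < n"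
  shows "(\<lambda>b. b t) \<in> borel_measurable M"
  unfolding measurable_cong_sets[OF assms(1) refl] bid_space_def
  using assms(2) by (intro measurable_component_singleton) simp

lemma profile_component_measurable:
  assumes "\<And>i. i \<in> I \<Longrightarrow> sets (M i) = sets (bid_space n)" "i \<in> I" "t < n"
  shows "(\<lambda>p. p i t) \<in> borel_measurable (PiM I M)"
  using measurable_compose[OF measurable_component_singleton[OF assms(2), of M]
      bid_component_measurable[OF assms(1)[OF assms(2)] assms(3)]] .

lemma wins_measurable:
  assumes "\<And>i. i < k \<Longrightarrow> sets (M i) = sets (bid_space n)" "j < k"
  shows "(\<lambda>p. wins n k p j) \<in> borel_measurable (PiM {..<k} M)"
proof -
  have comp: "(\<lambda>p. p i t) \<in> borel_measurable (PiM {..<k} M)" if "i < k" "t < n" for i t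
    using assms that by (intro profile_component_measurable[where n = n]) auto
  have le: "Measurable.pred (PiM {..<k} M) (\<lambda>p. p i t \<le> p j t)"
    and eq: "Measurable.pred (PiM {..<k} M) (\<lambda>p. p i t = p j t)" if "i < k" "t < n" for i t
    using comp[OF that] comp[OF assms(2) that(2)]
    by (auto intro!: pred_def[THEN iffD2] borel_measurable_le borel_measurable_eq)
  have max: "Measurable.pred (PiM {..<k} M) (\<lambda>p. \<forall>i<k. p i t \<le> p j t)" if "t < n" for t
  proof -
    have "Measurable.pred (PiM {..<k} M) (\<lambda>p. \<forall>i\<in>{..<k}. p i t \<le> p j t)"
      by (rule pred_intros_finite(3)) (use le that in auto)
    then show ?thesis
      unfolding Ball_def lessThan_iff .
  qed
  \<comment> \<open>Written as a finite sum of indicators, the size of the tie is measurable term by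
    term.\<close>
  have card_eq: "real (card {i. i < k \<and> p i t = p j t}) = (\<Sum>i<k. of_bool (p i t = p j t))" for p t
  proof -
    have "{i. i < k \<and> p i t = p j t} = {..<k} \<inter> {i. p i t = p j t}"
      by auto
    then show ?thesis
      by simp
  qed
  have count: "(\<lambda>p. \<Sum>i<k. of_bool (p i t = p j t) :: real) \<in> borel_measurable (PiM {..<k} M)"
    if "t < n" for t
  proof (rule borel_measurable_sum)
    fix i assume "i \<in> {..<k}"
    then show "(\<lambda>p. of_bool (p i t = p j t) :: real) \<in> borel_measurable (PiM {..<k} M)"
      unfolding of_bool_def using that by (intro measurable_If borel_measurable_const eq[THEN predE]) simp_all
  qed
  show ?thesis
    unfolding wins_def card_eq
  proof (rule borel_measurable_sum)
    fix t assume "t \<in> {..<n}"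
    then show "(\<lambda>p. if \<forall>i<k. p i t \<le> p j t then 1 / (\<Sum>i<k. of_bool (p i t = p j t)) else 0 :: real)
        \<in> borel_measurable (PiM {..<k} M)"
      by (intro measurable_If borel_measurable_divide borel_measurable_const count max[THEN predE]) simp_all
  qed
qed

text \<open>One share is at most the sum of all shares, which is n; a bounded measurable function on
  a probability space is integrable.\<close>

lemma wins_integrable:
  assumes "\<And>i. i < k \<Longrightarrow> prob_space (M i)"
    and "\<And>i. i < k \<Longrightarrow> sets (M i) = sets (bid_space n)" "j < k"
  shows "integrable (PiM {..<k} M) (\<lambda>p. wins n k p j)"
proof -
  interpret prob_space "PiM {..<k} M"
    using assms by (intro prob_space_PiM) auto
  have "wins n k p j \<le> real n" for p
  proof -
    have "wins n k p j \<le> (\<Sum>j<k. wins n k p j)"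
      using assms(3) by (intro member_le_sum) (auto simp: wins_nonneg)
    then show ?thesis
      using assms(3) sum_wins[of k n p] by simp
  qed
  then show ?thesis
    using wins_measurable[OF assms(2,3)]
    by (intro integrable_const_bound[of _ "real n"]) (auto simp: wins_nonneg)
qed

section \<open>Expected shares: total and symmetry\<close>

lemma sum_expected_wins:
  assumes "\<And>i. i < k \<Longrightarrow> prob_space (M i)"
    and "\<And>i. i < k \<Longrightarrow> sets (M i) = sets (bid_space n)" "k > 0"
  shows "(\<Sum>j<k. \<integral>p. wins n k p j \<partial>PiM {..<k} M) = real n"
proof -
  interpret prob_space "PiM {..<k} M"
    using assms by (intro prob_space_PiM) auto
  have "(\<Sum>j<k. \<integral>p. wins n k p j \<partial>PiM {..<k} M) = (\<integral>p. (\<Sum>j<k. wins n k p j) \<partial>PiM {..<k} M)"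
    using assms by (subst Bochner_Integration.integral_sum) (auto intro!: wins_integrable)
  then show ?thesis
    using assms(3) by (simp add: sum_wins prob_space)
qed

text \<open>Swapping two bidders with the same strategy leaves the product measure invariant and
  carries the share of one to the share of the other.\<close>

lemma expected_wins_cong:
  assumes "\<And>i. i < k \<Longrightarrow> prob_space (M i)"
    and "\<And>i. i < k \<Longrightarrow> sets (M i) = sets (bid_space n)"
    and "j < k" "j' < k" "M j = M j'"
  shows "(\<integral>p. wins n k p j \<partial>PiM {..<k} M) = (\<integral>p. wins n k p j' \<partial>PiM {..<k} M)"
proof -
  define f where "f = Transposition.transpose j j'"
  have f: "bij_betw f {..<k} {..<k}"
    unfolding f_def using assms(3,4)
    by (intro bij_betw_byWitness[of _ "Transposition.transpose j j'"])
       (auto simp: Transposition.transpose_def)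
  have M: "M (f i) = M i" for i
    using assms(5) by (auto simp: f_def Transposition.transpose_def)
  have meas: "(\<lambda>p. \<lambda>i\<in>{..<k}. p (f i)) \<in> PiM {..<k} M \<rightarrow>\<^sub>M PiM {..<k} M"
  proof (rule measurable_restrict)
    fix i assume "i \<in> {..<k}"
    then have "f i \<in> {..<k}"
      using f by (auto simp: bij_betw_def)
    then show "(\<lambda>p. p (f i)) \<in> PiM {..<k} M \<rightarrow>\<^sub>M M i"
      using measurable_component_singleton[of "f i" "{..<k}" M] by (simp add: M)
  qed
  have "distr (PiM {..<k} M) (PiM {..<k} (\<lambda>i. M (f i))) (\<lambda>p. \<lambda>i\<in>{..<k}. p (f i)) =
      PiM {..<k} (\<lambda>i. M (f i))"
    using assms(1) f by (intro distr_PiM_reindex) (auto simp: bij_betw_def)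
  then have distr: "distr (PiM {..<k} M) (PiM {..<k} M) (\<lambda>p. \<lambda>i\<in>{..<k}. p (f i)) = PiM {..<k} M"
    by (simp add: M)
  have "(\<integral>p. wins n k p j \<partial>PiM {..<k} M) =
      (\<integral>p. wins n k p j \<partial>distr (PiM {..<k} M) (PiM {..<k} M) (\<lambda>p. \<lambda>i\<in>{..<k}. p (f i)))"
    by (simp add: distr)
  also have "\<dots> = (\<integral>p. wins n k (\<lambda>i\<in>{..<k}. p (f i)) j \<partial>PiM {..<k} M)"
    by (rule integral_distr[OF meas wins_measurable[OF assms(2,3)]])
  also have "\<dots> = (\<integral>p. wins n k p j' \<partial>PiM {..<k} M)"
    using assms(3) by (simp add: wins_permute[OF f]) (simp add: f_def)
  finally show ?thesis .
qed

section \<open>Auctions against the Dirichlet algorithm\<close>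

text \<open>The k m objects split into m consecutive blocks, and t mod k runs through 0, ..., k - 1
  once in each.\<close>

lemma sum_mod_blocks:
  fixes f :: "nat \<Rightarrow> 'a::semiring_1"
  shows "(\<Sum>t<k * m. f (t mod k)) = of_nat m * (\<Sum>i<k. f i)"
proof -
  have "(\<Sum>t<k * m. f (t mod k)) = (\<Sum>l<m. \<Sum>t = l * k..<l * k + k. f (t mod k))"
    by (simp add: sum.nat_group mult.commute)
  also have "\<dots> = (\<Sum>l<m. \<Sum>i<k. f i)"
  proof (rule sum.cong[OF refl])
    fix l
    show "(\<Sum>t = l * k..<l * k + k. f (t mod k)) = (\<Sum>i<k. f i)"
      using sum.shift_bounds_nat_ivl[of "\<lambda>t. f (t mod k)" 0 "l * k" k]
      by (simp add: atLeast0LessThan add.commute)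
  qed
  finally show ?thesis by simp
qed

lemma sum_simplex_pt:
  assumes "k > 0"
  shows "(\<Sum>i<k. simplex_pt k y i) = 1"
proof -
  obtain l where "k = Suc l"
    using assms by (cases k) auto
  then show ?thesis
    by (simp add: simplex_pt_def)
qed

lemma dir_alg_map_measurable:
  "(\<lambda>y. \<lambda>t\<in>{..<k * m}. simplex_pt k y (t mod k) / real m) \<in> dir_measure k \<rightarrow>\<^sub>M bid_space (k * m)"
  unfolding bid_space_def dir_measure_def by measurable

text \<open>Each of the m blocks costs (d_1 + ... + d_k)/m = 1/m, so the budget is spent exactly;
  positivity of the bids holds almost surely, as the density lives on the open simplex.\<close>

lemma strategy_dir_alg:
  assumes "k \<ge> 2" "m \<ge> 1"
  shows "strategy (k * m) (dir_alg k m)"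
proof -
  interpret dir: prob_space "dir_measure k"
    using assms(1) by (rule prob_space_dir_measure)
  let ?bid = "\<lambda>y. \<lambda>t\<in>{..<k * m}. simplex_pt k y (t mod k) / real m"
  have valid: "valid_bid (k * m) (?bid y)" if "y \<in> open_simplex k" for y
  proof -
    have "(\<Sum>t<k * m. ?bid y t) = (\<Sum>t<k * m. simplex_pt k y (t mod k)) / real m"
      by (simp add: sum_divide_distrib)
    also have "\<dots> = 1"
      using assms by (simp add: sum_mod_blocks sum_simplex_pt)
    finally show ?thesis
      using that assms by (auto simp: valid_bid_def open_simplex_def)
  qed
  have pred: "{b \<in> space (bid_space (k * m)). valid_bid (k * m) b} \<in> sets (bid_space (k * m))"
    unfolding valid_bid_def bid_space_def by measurable
  have "AE b in dir_alg k m. valid_bid (k * m) b"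
    unfolding dir_alg_def
    using AE_dir_measure_open_simplex[OF assms(1)]
    by (subst AE_distr_iff[OF dir_alg_map_measurable pred]) (auto elim!: eventually_mono intro: valid)
  moreover have "prob_space (dir_alg k m)"
    unfolding dir_alg_def by (rule dir.prob_space_distr[OF dir_alg_map_measurable])
  moreover have "sets (dir_alg k m) = sets (bid_space (k * m))"
    by (simp only: dir_alg_def sets_distr)
  ultimately show ?thesis
    unfolding strategy_def by (intro conjI)
qed

lemma emeasure_dir_alg_le:
  assumes "k \<ge> 2" "m \<ge> 1" "t < k * m" "x \<ge> 0"
  shows "emeasure (dir_alg k m) {b \<in> space (dir_alg k m). b t \<le> x} \<le>
    ennreal ((real m * x) powr (1 / (real k - 1)))"
proof -
  have meas: "{b \<in> space (bid_space (k * m)). b t \<le> x} \<in> sets (bid_space (k * m))"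
    using bid_component_measurable[OF refl assms(3)] by measurable
  have "emeasure (dir_alg k m) {b \<in> space (dir_alg k m). b t \<le> x} =
      emeasure (dir_measure k) {y \<in> space (dir_measure k). simplex_pt k y (t mod k) \<le> real m * x}"
    unfolding dir_alg_def space_distr emeasure_distr[OF dir_alg_map_measurable meas]
    using assms measurable_space[OF dir_alg_map_measurable, of _ k m]
    by (intro arg_cong[where f = "emeasure _"]) (auto simp: field_simps)
  also have "\<dots> \<le> ennreal ((real m * x) powr (1 / (real k - 1)))"
    using assms by (intro emeasure_dir_measure_le) auto
  finally show ?thesis .
qed

text \<open>All $k-1$ independent bids on an object are at most $x$ with probability at most
  $((mx)^{1/(k-1)})^{k-1} = mx$, so a unit budget buys the adversary at most $m$ objects.\<close>

lemma exp_wins_adversary_le: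
  assumes k: "k \<ge> 2" and m: "m \<ge> 1" and A: "strategy (k * m) A"
  shows "exp_wins (k * m) k A (dir_alg k m) 0 \<le> real m"
proof -
  define n where "n = k * m"
  define D where "D = dir_alg k m"
  define M where "M = (\<lambda>i::nat. if i = 0 then A else D)"
  have D: "strategy n D"
    unfolding n_def D_def using k m by (rule strategy_dir_alg)
  have prob: "prob_space (M i)" and sets_M: "sets (M i) = sets (bid_space n)" for i
    using A D by (simp_all add: M_def strategy_def n_def)
  interpret A: prob_space A
    using A by (simp add: strategy_def)
  interpret M: product_prob_space M UNIV
    by (rule product_prob_spaceI) (rule prob)
  have split: "{..<k} = insert 0 {1..<k}"
    using k by auto
  have bid_A: "(\<lambda>b. b t) \<in> borel_measurable A" if "t < n" for t
    using A that by (intro bid_component_measurable) (auto simp: strategy_def n_def)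
  have valid_A: "AE b in A. valid_bid n b"
    using A by (simp add: strategy_def n_def)
  have object: "(\<integral>\<^sup>+ p. of_bool (\<forall>i<k. p i t \<le> p 0 t) \<partial>PiM {..<k} M)
      \<le> (\<integral>\<^sup>+ b. ennreal (real m * b t) \<partial>A)" if t: "t < n" for t
  proof -
    \<comment> \<open>The comparison of the adversary with himself is trivial, so only bidders 1 to
      k - 1 matter.\<close>
    let ?f = "\<lambda>p. of_bool (\<forall>i\<in>{1..<k}. p i t \<le> p 0 t) :: ennreal"
    have bid: "(\<lambda>p. p i t) \<in> borel_measurable (PiM I M)" if "i \<in> I" for i I
      using sets_M that t by (intro profile_component_measurable[where n = n]) auto
    have pred: "{p \<in> space (PiM {..<k} M). \<forall>i\<in>{1..<k}. p i t \<le> p 0 t} \<in> sets (PiM {..<k} M)"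
      using k by (intro sets.sets_Collect_finite_All borel_measurable_le bid) auto
    have f: "?f \<in> borel_measurable (PiM (insert 0 {1..<k}) M)"
      unfolding of_bool_def split[symmetric]
      by (intro measurable_If borel_measurable_const pred)
    have D_le: "{d \<in> space D. d t \<le> x} \<in> sets (M i)" if "i \<in> {1..<k}" for i x
    proof -
      have "{d \<in> space (M i). d t \<le> x} \<in> sets (M i)"
        by (intro borel_measurable_le borel_measurable_const bid_component_measurable[OF sets_M t])
      then show ?thesis
        using that by (simp add: M_def)
    qed
    have "(\<integral>\<^sup>+ p. of_bool (\<forall>i<k. p i t \<le> p 0 t) \<partial>PiM {..<k} M) = integral\<^sup>N (PiM (insert 0 {1..<k}) M) ?f"
      unfolding split by (intro nn_integral_cong arg_cong[where f = of_bool]) (auto simp: Suc_le_eq)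
    \<comment> \<open>Independence enters here: the adversary's bid vector b is fixed, and the inner
      integral is over the other bidders. For fixed b the event is a box with the same side for each
      of them.\<close>
    also have "\<dots> = (\<integral>\<^sup>+ b. \<integral>\<^sup>+ q. ?f (q(0 := b)) \<partial>PiM {1..<k} M \<partial>M 0)"
      by (intro M.product_nn_integral_insert_rev f) auto
    also have "\<dots> = (\<integral>\<^sup>+ b. emeasure (PiM {1..<k} M) (PiE {1..<k} (\<lambda>_. {d \<in> space D. d t \<le> b t})) \<partial>A)"
    proof -
      have D_box: "PiE {1..<k} (\<lambda>_. {d \<in> space D. d t \<le> x}) \<in> sets (PiM {1..<k} M)" for x
        by (intro sets_PiM_I_finite finite_atLeastLessThan D_le)
      have box: "?f (q(0 := b)) = indicator (PiE {1..<k} (\<lambda>_. {d \<in> space D. d t \<le> b t})) q"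
        if "q \<in> space (PiM {1..<k} M)" for q b
        using that by (auto simp: indicator_def space_PiM PiE_iff M_def)
      have "(\<integral>\<^sup>+ q. ?f (q(0 := b)) \<partial>PiM {1..<k} M) =
          (\<integral>\<^sup>+ q. indicator (PiE {1..<k} (\<lambda>_. {d \<in> space D. d t \<le> b t})) q \<partial>PiM {1..<k} M)" for b
        by (intro nn_integral_cong box)
      then have "(\<integral>\<^sup>+ q. ?f (q(0 := b)) \<partial>PiM {1..<k} M) =
          emeasure (PiM {1..<k} M) (PiE {1..<k} (\<lambda>_. {d \<in> space D. d t \<le> b t}))" for b
        by (simp only: nn_integral_indicator D_box)
      moreover have "M 0 = A"
        by (simp add: M_def)
      ultimately show ?thesis
        by (simp only:)
    qed
    also have "\<dots> = (\<integral>\<^sup>+ b. emeasure D {d \<in> space D. d t \<le> b t} ^ (k - 1) \<partial>A)"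
    proof (rule nn_integral_cong)
      fix b
      have "emeasure (PiM {1..<k} M) (PiE {1..<k} (\<lambda>_. {d \<in> space D. d t \<le> b t})) =
          (\<Prod>i\<in>{1..<k}. emeasure (M i) {d \<in> space D. d t \<le> b t})"
        by (intro M.emeasure_PiM finite_atLeastLessThan D_le)
      also have "\<dots> = emeasure D {d \<in> space D. d t \<le> b t} ^ (k - 1)"
        by (simp add: M_def)
      finally show "emeasure (PiM {1..<k} M) (PiE {1..<k} (\<lambda>_. {d \<in> space D. d t \<le> b t})) =
          emeasure D {d \<in> space D. d t \<le> b t} ^ (k - 1)" .
    qed
    also have "\<dots> \<le> (\<integral>\<^sup>+ b. ennreal (real m * b t) \<partial>A)"
    proof (intro nn_integral_mono_AE, use valid_A in eventually_elim)
      fix b assume "valid_bid n b"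
      then have b: "b t > 0"
        using t by (simp add: valid_bid_def)
      have "emeasure D {d \<in> space D. d t \<le> b t} ^ (k - 1) \<le>
          ennreal ((real m * b t) powr (1 / (real k - 1))) ^ (k - 1)"
        unfolding D_def using k m t b by (intro power_mono emeasure_dir_alg_le) (auto simp: n_def)
      also have "\<dots> = ennreal (((real m * b t) powr (1 / (real k - 1))) powr real (k - 1))"
        using b m by (simp add: ennreal_power powr_realpow)
      also have "\<dots> = ennreal (real m * b t)"
        using k b m by (simp add: powr_powr of_nat_diff)
      finally show "emeasure D {d \<in> space D. d t \<le> b t} ^ (k - 1) \<le> ennreal (real m * b t)" .
    qed
    finally show ?thesis .
  qed
  have indicator_meas: "(\<lambda>p. of_bool (\<forall>i<k. p i t \<le> p 0 t) :: ennreal) \<in> borel_measurable (PiM {..<k} M)"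
    if t: "t < n" for t
  proof -
    have "{p \<in> space (PiM {..<k} M). \<forall>i\<in>{..<k}. p i t \<le> p 0 t} \<in> sets (PiM {..<k} M)"
      using k t sets_M
      by (intro sets.sets_Collect_finite_All borel_measurable_le profile_component_measurable[where n = n]) auto
    then show ?thesis
      unfolding of_bool_def Ball_def lessThan_iff
      by (intro measurable_If borel_measurable_const)
  qed
  have "ennreal (exp_wins n k A D 0) = (\<integral>\<^sup>+ p. ennreal (wins n k p 0) \<partial>PiM {..<k} M)"
    unfolding exp_wins_def M_def[symmetric] using k prob sets_M
    by (intro nn_integral_eq_integral[symmetric] wins_integrable) (auto simp: wins_nonneg)
  also have "\<dots> \<le> (\<integral>\<^sup>+ p. (\<Sum>t<n. of_bool (\<forall>i<k. p i t \<le> p 0 t)) \<partial>PiM {..<k} M)"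
  proof (rule nn_integral_mono)
    fix p
    have "ennreal (wins n k p 0) \<le> ennreal (\<Sum>t<n. of_bool (\<forall>i<k. p i t \<le> p 0 t))"
      using k by (intro ennreal_leI wins_le_count) auto
    also have "\<dots> = (\<Sum>t<n. ennreal (of_bool (\<forall>i<k. p i t \<le> p 0 t)))"
      by (subst sum_ennreal) auto
    also have "\<dots> = (\<Sum>t<n. of_bool (\<forall>i<k. p i t \<le> p 0 t))"
      by (intro sum.cong) (auto simp: of_bool_def)
    finally show "ennreal (wins n k p 0) \<le> (\<Sum>t<n. of_bool (\<forall>i<k. p i t \<le> p 0 t))" .
  qed
  also have "\<dots> = (\<Sum>t<n. \<integral>\<^sup>+ p. of_bool (\<forall>i<k. p i t \<le> p 0 t) \<partial>PiM {..<k} M)"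
    by (intro nn_integral_sum indicator_meas) simp
  also have "\<dots> \<le> (\<Sum>t<n. \<integral>\<^sup>+ b. ennreal (real m * b t) \<partial>A)"
    by (intro sum_mono object) simp
  also have "\<dots> = (\<integral>\<^sup>+ b. (\<Sum>t<n. ennreal (real m * b t)) \<partial>A)"
    using bid_A
    by (intro nn_integral_sum[symmetric] measurable_compose[OF _ measurable_ennreal] borel_measurable_times) auto
  \<comment> \<open>The bound m b_t is linear in the bid, so its sum over the objects depends only
    on the total spent, which is at most 1.\<close>
  also have "\<dots> \<le> (\<integral>\<^sup>+ b. ennreal (real m) \<partial>A)"
  proof (intro nn_integral_mono_AE, use valid_A in eventually_elim)
    fix b assume b: "valid_bid n b"
    then have "(\<Sum>t<n. ennreal (real m * b t)) = ennreal (real m * (\<Sum>t<n. b t))"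
      by (subst sum_ennreal) (auto simp: valid_bid_def sum_distrib_left less_imp_le)
    also have "\<dots> \<le> ennreal (real m)"
      using b by (intro ennreal_leI) (auto simp: valid_bid_def intro!: mult_left_le)
    finally show "(\<Sum>t<n. ennreal (real m * b t)) \<le> ennreal (real m)" .
  qed
  also have "\<dots> = ennreal (real m)"
    by (simp add: A.emeasure_space_1)
  finally show ?thesis
    by (simp add: n_def D_def)
qed

section \<open>The guarantee against every adversary, and its optimality by imitation\<close>

theorem theorem3p5:
  fixes k m n :: nat
  assumes "k \<ge> 2" and "m \<ge> 1" and "n = k * m"
  shows "strategy n (dir_alg k m) \<and>
    (\<forall>A. strategy n A \<longrightarrow>
        (\<forall>j\<in>{1..<k}. exp_wins n k A (dir_alg k m) j \<ge> real n / real k)) \<and>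
    (\<forall>D. strategy n D \<longrightarrow>
        (\<exists>A. strategy n A \<and> (\<forall>j\<in>{1..<k}. exp_wins n k A D j \<le> real n / real k)))"
proof (intro conjI allI impI ballI)
  show alg: "strategy n (dir_alg k m)"
    unfolding assms(3) using assms(1,2) by (rule strategy_dir_alg)
  \<comment> \<open>Two bidders are interchangeable if they are both disadvantaged, or if the
    adversary uses the common algorithm as well.\<close>
  have sym: "exp_wins n k A D j = exp_wins n k A D j'"
    if "strategy n A" "strategy n D" "j < k" "j' < k" "(j = 0 \<longleftrightarrow> j' = 0) \<or> A = D" for A D j j'
    unfolding exp_wins_def using that by (intro expected_wins_cong[where n = n]) (auto simp: strategy_def)
  have total: "(\<Sum>j<k. exp_wins n k A D j) = real n" if "strategy n A" "strategy n D" for A D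
    unfolding exp_wins_def using that assms(1) by (intro sum_expected_wins) (auto simp: strategy_def)
  have n_div_k: "real n / real k = real m"
    using assms by simp
  {
    fix A j assume A: "strategy n A" and j: "j \<in> {1..<k}"
    have "{..<k} = insert 0 {1..<k}"
      using assms(1) by auto
    then have "real n = exp_wins n k A (dir_alg k m) 0 + (\<Sum>i\<in>{1..<k}. exp_wins n k A (dir_alg k m) i)"
      using total[OF A alg] by simp
    also have "(\<Sum>i\<in>{1..<k}. exp_wins n k A (dir_alg k m) i) = (\<Sum>i\<in>{1..<k}. exp_wins n k A (dir_alg k m) j)"
      using j by (intro sum.cong sym[OF A alg]) auto
    also have "\<dots> = (real k - 1) * exp_wins n k A (dir_alg k m) j"
      using assms(1) by (simp add: of_nat_diff)
    \<comment> \<open>At least n - m = (k-1) m objects in expectation remain, shared equally by k -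
      1 bidders.\<close>
    also have "exp_wins n k A (dir_alg k m) 0 \<le> real m"
      using exp_wins_adversary_le[OF assms(1,2)] A assms(3) by simp
    finally have "(real k - 1) * real m \<le> (real k - 1) * exp_wins n k A (dir_alg k m) j"
      using assms(3) by (simp add: algebra_simps)
    then show "exp_wins n k A (dir_alg k m) j \<ge> real n / real k"
      using assms(1) unfolding n_div_k by simp
  }
  fix D assume D: "strategy n D"
  \<comment> \<open>The adversary copies \<open>D\<close>; then all k expected shares coincide and
    sum to n, so each equals n/k.\<close>
  have "exp_wins n k D D j \<le> real n / real k" if "j \<in> {1..<k}" for j
  proof -
    have "real n = (\<Sum>i<k. exp_wins n k D D j)"
      unfolding total[OF D D, symmetric] using that by (intro sum.cong sym[OF D D]) auto
    then show ?thesis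
      using assms(1) by simp
  qed
  with D show "\<exists>A. strategy n A \<and> (\<forall>j\<in>{1..<k}. exp_wins n k A D j \<le> real n / real k)"
    by blast
qed

end
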